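(* Let $K$ be given by a radial basis function, i.e. $K(x,y)=\phi(\|x-y\|_2)$ for all $x,y\in\mathbb{R}^d$ with some function $\phi$. Then, for every $r>0$ for which it exists, the norm-minimal bump function $b_r^*$ on the ball $B_r(0)$ is radial.
   Context: $K$ is a continuous symmetric positive definite translation-invariant real-valued kernel on $\mathbb{R}^d\times\mathbb{R}^d$, and $\mathcal{K}$ is its native space, i.e. the Hilbert space of functions on $\mathbb{R}^d$ with norm $\|\cdot\|_K$ for which $K$ is the reproducing kernel. The set of bump functions of support radius $r$ is $\mathcal{B}_r:=\{b\in\mathcal{K} : b(0)=1,\ b(y)=0 \text{ for all } \|y\|_2\ge r\}$, and the norm-minimal bump function $b_r^*$ is the element of $\mathcal{B}_r$ with $\|b_r^*\|_K=\inf\{\|b\|_K : b\in\mathcal{B}_r\}$. A function on $\mathbb{R}^d$ is radial if its value at $x$ depends only on $\|x\|_2$. *)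

theory Defs
  imports "HOL-Analysis.Analysis"
begin

text \<open>Positive definiteness is strict, as usual for radial basis functions: kernel matrices on
  finitely many distinct points are positive definite, not merely positive semidefinite.\<close>

definition positive_definite_kernel :: "('a \<Rightarrow> 'a \<Rightarrow> real) \<Rightarrow> bool" where
  "positive_definite_kernel K \<longleftrightarrow>
     (\<forall>X c. finite X \<longrightarrow> (\<exists>x\<in>X. c x \<noteq> 0) \<longrightarrow> 0 < (\<Sum>x\<in>X. \<Sum>y\<in>X. c x * c y * K x y))"

definition symmetric_kernel :: "('a \<Rightarrow> 'a \<Rightarrow> real) \<Rightarrow> bool" where
  "symmetric_kernel K \<longleftrightarrow> (\<forall>x y. K x y = K y x)"

definition translation_invariant_kernel :: "('a::ab_group_add \<Rightarrow> 'a \<Rightarrow> real) \<Rightarrow> bool" where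
  "translation_invariant_kernel K \<longleftrightarrow> (\<forall>x y z. K (x + z) (y + z) = K x y)"

text \<open>The native space is the Hilbert space \<open>H\<close> of functions, with pointwise vector space operations
  and inner product \<open>ip\<close>, in which \<open>K\<close> is reproducing. Nothing is assumed about \<open>ip\<close>
  outside \<open>H\<close>. The pair is determined by \<open>K\<close>, up to those irrelevant values of \<open>ip\<close>.\<close>

definition native_norm :: "(('a \<Rightarrow> real) \<Rightarrow> ('a \<Rightarrow> real) \<Rightarrow> real) \<Rightarrow> ('a \<Rightarrow> real) \<Rightarrow> real" where
  "native_norm ip f = sqrt (ip f f)"

locale hilbert_function_space =
  fixes H :: "('a \<Rightarrow> real) set"
    and ip :: "('a \<Rightarrow> real) \<Rightarrow> ('a \<Rightarrow> real) \<Rightarrow> real"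
  assumes zero_mem: "(\<lambda>x. 0) \<in> H"
    and add_mem: "\<lbrakk>f \<in> H; g \<in> H\<rbrakk> \<Longrightarrow> (\<lambda>x. f x + g x) \<in> H"
    and scale_mem: "f \<in> H \<Longrightarrow> (\<lambda>x. c * f x) \<in> H"
    and ip_commute: "\<lbrakk>f \<in> H; g \<in> H\<rbrakk> \<Longrightarrow> ip f g = ip g f"
    and ip_add_left: "\<lbrakk>f \<in> H; g \<in> H; h \<in> H\<rbrakk> \<Longrightarrow> ip (\<lambda>x. f x + g x) h = ip f h + ip g h"
    and ip_scale_left: "\<lbrakk>f \<in> H; g \<in> H\<rbrakk> \<Longrightarrow> ip (\<lambda>x. c * f x) g = c * ip f g"
    and ip_pos: "\<lbrakk>f \<in> H; f \<noteq> (\<lambda>x. 0)\<rbrakk> \<Longrightarrow> 0 < ip f f"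
    and complete:
      "\<lbrakk>\<And>n. F n \<in> H;
        \<And>e. 0 < e \<Longrightarrow> \<exists>N. \<forall>m\<ge>N. \<forall>n\<ge>N. native_norm ip (\<lambda>x. F m x - F n x) < e\<rbrakk>
       \<Longrightarrow> \<exists>f\<in>H. (\<lambda>n. native_norm ip (\<lambda>x. F n x - f x)) \<longlonglongrightarrow> 0"

locale native_space = hilbert_function_space H ip
  for K :: "'a \<Rightarrow> 'a \<Rightarrow> real"
    and H :: "('a \<Rightarrow> real) set"
    and ip :: "('a \<Rightarrow> real) \<Rightarrow> ('a \<Rightarrow> real) \<Rightarrow> real" +
  assumes kernel_mem: "(\<lambda>y. K y x) \<in> H"
    and reproducing: "f \<in> H \<Longrightarrow> ip f (\<lambda>y. K y x) = f x"

definition bump_functions ::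
    "('a::real_normed_vector \<Rightarrow> real) set \<Rightarrow> real \<Rightarrow> ('a \<Rightarrow> real) set" where
  "bump_functions H r = {b \<in> H. b 0 = 1 \<and> (\<forall>y. r \<le> norm y \<longrightarrow> b y = 0)}"

definition norm_minimal_bump ::
    "('a::real_normed_vector \<Rightarrow> real) set \<Rightarrow> (('a \<Rightarrow> real) \<Rightarrow> ('a \<Rightarrow> real) \<Rightarrow> real)
     \<Rightarrow> real \<Rightarrow> ('a \<Rightarrow> real) \<Rightarrow> bool" where
  "norm_minimal_bump H ip r b \<longleftrightarrow>
     b \<in> bump_functions H r \<and> native_norm ip b = (INF c\<in>bump_functions H r. native_norm ip c)"

definition radial :: "('a::real_normed_vector \<Rightarrow> real) \<Rightarrow> bool" where
  "radial f \<longleftrightarrow> (\<exists>\<psi>. \<forall>x. f x = \<psi> (norm x))"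

end

theory Submission imports Defs begin

text \<open>An isometry \<open>T\<close> of \<open>\<real>\<^sup>d\<close> fixing the origin preserves the kernel, so composition
  with \<open>T\<close> is a linear isometry of the native space and maps bump functions to bump functions. If
  \<open>b\<close> is norm-minimal, then so is \<open>b \<circ> T\<close>, and by the parallelogram law the midpoint of two distinct
  minimisers would have smaller norm. Hence \<open>b \<circ> T = b\<close>, and such \<open>T\<close> act transitively on
  spheres.\<close>

section \<open>Inner product algebra and the Cauchy-Schwarz inequality\<close>

context hilbert_function_space
begin

lemma diff_mem: "\<lbrakk>f \<in> H; g \<in> H\<rbrakk> \<Longrightarrow> (\<lambda>x. f x - g x) \<in> H"
  using add_mem[of f "\<lambda>x. -1 * g x"] scale_mem[of g "-1"] by simp

lemma ip_diff_left:
  "\<lbrakk>f \<in> H; g \<in> H; h \<in> H\<rbrakk> \<Longrightarrow> ip (\<lambda>x. f x - g x) h = ip f h - ip g h"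
  using ip_add_left[of f "\<lambda>x. -1 * g x" h] scale_mem[of g "-1"] ip_scale_left[of g h "-1"] by simp

lemma ip_diff_right:
  "\<lbrakk>f \<in> H; g \<in> H; h \<in> H\<rbrakk> \<Longrightarrow> ip h (\<lambda>x. f x - g x) = ip h f - ip h g"
  by (simp add: ip_commute[of h] ip_diff_left diff_mem)

lemma ip_add_right:
  "\<lbrakk>f \<in> H; g \<in> H; h \<in> H\<rbrakk> \<Longrightarrow> ip h (\<lambda>x. f x + g x) = ip h f + ip h g"
  by (simp add: ip_commute[of h] ip_add_left add_mem)

lemma ip_scale_right: "\<lbrakk>f \<in> H; h \<in> H\<rbrakk> \<Longrightarrow> ip h (\<lambda>x. c * f x) = c * ip h f"
  by (simp add: ip_commute[of h] ip_scale_left scale_mem)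

lemma ip_zero_left: "h \<in> H \<Longrightarrow> ip (\<lambda>x. 0) h = 0"
  using ip_scale_left[of h h 0] by simp

lemma ip_nonneg: "f \<in> H \<Longrightarrow> 0 \<le> ip f f"
  using ip_pos[of f] ip_zero_left[of f] by (cases "f = (\<lambda>x. 0)") auto

lemma native_norm_nonneg: "f \<in> H \<Longrightarrow> 0 \<le> native_norm ip f"
  by (simp add: native_norm_def ip_nonneg)

lemma native_norm_sq: "f \<in> H \<Longrightarrow> (native_norm ip f)\<^sup>2 = ip f f"
  by (simp add: native_norm_def ip_nonneg)

lemma ip_add_scale_self:
  assumes "f \<in> H" "g \<in> H"
  shows "ip (\<lambda>x. f x + c * g x) (\<lambda>x. f x + c * g x) = ip f f + 2 * c * ip f g + c\<^sup>2 * ip g g"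
proof -
  have g: "(\<lambda>x. c * g x) \<in> H"
    using assms(2) by (rule scale_mem)
  show ?thesis
    using assms g ip_commute[OF assms(2,1)]
    by (simp add: ip_add_left ip_add_right ip_scale_left ip_scale_right add_mem power2_eq_square)
qed

lemma cauchy_schwarz:
  assumes f: "f \<in> H" and g: "g \<in> H"
  shows "\<bar>ip f g\<bar> \<le> native_norm ip f * native_norm ip g"
proof (cases "g = (\<lambda>x. 0)")
  case True
  then have "ip f g = 0"
    using ip_commute[OF f g] ip_zero_left[OF f] by simp
  then show ?thesis
    by (simp add: native_norm_nonneg f g)
next
  case False
  then have pos: "0 < ip g g"
    using g by (rule ip_pos[rotated])
  \<comment> \<open>This \<open>c\<close> minimises the quadratic
    \<open>ip f f + 2 * c * ip f g + c^2 * ip g g\<close>; nonnegativity at the minimum is the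
    inequality.\<close>
  define c where "c = - ip f g / ip g g"
  have "0 \<le> ip f f + 2 * c * ip f g + c\<^sup>2 * ip g g"
    using ip_nonneg[OF add_mem[OF f scale_mem[OF g]]] by (simp add: ip_add_scale_self f g)
  also have "\<dots> = ip f f - (ip f g)\<^sup>2 / ip g g"
    using pos by (simp add: c_def field_simps power2_eq_square)
  finally have "(ip f g)\<^sup>2 \<le> ip f f * ip g g"
    using pos by (simp add: field_simps)
  then have "sqrt ((ip f g)\<^sup>2) \<le> sqrt (ip f f * ip g g)"
    by (rule real_sqrt_le_mono)
  then show ?thesis
    by (simp add: native_norm_def real_sqrt_mult)
qed

section \<open>Norm convergence\<close>

lemma tendsto_ip_left:
  assumes F: "\<And>n. F n \<in> H" and f: "f \<in> H" and h: "h \<in> H"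
    and lim: "(\<lambda>n. native_norm ip (\<lambda>x. F n x - f x)) \<longlonglongrightarrow> 0"
  shows "(\<lambda>n. ip (F n) h) \<longlonglongrightarrow> ip f h"
proof -
  have "\<bar>ip (F n) h - ip f h\<bar> \<le> native_norm ip (\<lambda>x. F n x - f x) * native_norm ip h" for n
    using cauchy_schwarz[OF diff_mem[OF F f] h, of n] by (simp add: ip_diff_left F f h)
  moreover have "(\<lambda>n. native_norm ip (\<lambda>x. F n x - f x) * native_norm ip h) \<longlonglongrightarrow> 0"
    using tendsto_mult_right[OF lim] by simp
  ultimately have "(\<lambda>n. ip (F n) h - ip f h) \<longlonglongrightarrow> 0"
    by (intro Lim_null_comparison[of "\<lambda>n. ip (F n) h - ip f h"]) auto
  then show ?thesis
    by (simp add: LIM_zero_iff)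
qed

text \<open>Triangle inequality through the limit, with Cauchy-Schwarz bounding the cross term. It
  serves to carry the Cauchy property over to a composed sequence whose limit is not yet known to
  lie in \<open>H\<close>.\<close>

lemma convergent_imp_cauchy:
  assumes F: "\<And>n. F n \<in> H" and f: "f \<in> H"
    and lim: "(\<lambda>n. native_norm ip (\<lambda>x. F n x - f x)) \<longlonglongrightarrow> 0"
    and e: "0 < e"
  shows "\<exists>N. \<forall>m\<ge>N. \<forall>n\<ge>N. native_norm ip (\<lambda>x. F m x - F n x) < e"
proof -
  let ?D = "\<lambda>n x. F n x - f x"
  have D: "?D n \<in> H" for n
    using F f by (rule diff_mem)
  obtain N where N: "\<And>n. n \<ge> N \<Longrightarrow> native_norm ip (?D n) < e / 2"
    using LIMSEQ_D[OF lim, of "e / 2"] e by fastforce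
  have "native_norm ip (\<lambda>x. F m x - F n x) < e" if "m \<ge> N" "n \<ge> N" for m n
  proof -
    have FF: "(\<lambda>x. F m x - F n x) \<in> H"
      using F F by (rule diff_mem)
    have "(\<lambda>x. F m x - F n x) = (\<lambda>x. ?D m x - ?D n x)"
      by simp
    then have "(native_norm ip (\<lambda>x. F m x - F n x))\<^sup>2
        = ip (\<lambda>x. ?D m x - ?D n x) (\<lambda>x. ?D m x - ?D n x)"
      using native_norm_sq[OF FF] by metis
    also have "\<dots> = ip (?D m) (?D m) - 2 * ip (?D m) (?D n) + ip (?D n) (?D n)"
      using ip_add_scale_self[OF D D, where c = "-1"] by simp
    also have "\<dots> \<le> (native_norm ip (?D m) + native_norm ip (?D n))\<^sup>2"
      using cauchy_schwarz[OF D D, of m n] 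
      by (simp add: power2_sum native_norm_sq D)
    finally have "native_norm ip (\<lambda>x. F m x - F n x)
        \<le> native_norm ip (?D m) + native_norm ip (?D n)"
      by (rule power2_le_imp_le) (simp add: native_norm_nonneg D)
    with N[OF that(1)] N[OF that(2)] show ?thesis
      by simp
  qed
  then show ?thesis
    by blast
qed

section \<open>Orthogonal projection onto a closed subspace\<close>

lemma ip_parallelogram:
  assumes f: "f \<in> H" and g: "g \<in> H" and h: "h \<in> H"
  shows "ip (\<lambda>x. f x - g x) (\<lambda>x. f x - g x)
    = 2 * ip (\<lambda>x. h x - f x) (\<lambda>x. h x - f x) + 2 * ip (\<lambda>x. h x - g x) (\<lambda>x. h x - g x)
      - 4 * ip (\<lambda>x. h x - (1/2) * (f x + g x)) (\<lambda>x. h x - (1/2) * (f x + g x))"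
  using assms ip_commute[OF f g] ip_commute[OF f h] ip_commute[OF g h]
  by (simp only: ip_add_left ip_add_right ip_diff_left ip_diff_right ip_scale_left ip_scale_right
      add_mem diff_mem scale_mem) (simp add: algebra_simps)

text \<open>A minimising sequence for the distance from \<open>f\<close> to \<open>S\<close> is
  Cauchy by the parallelogram law, and its limit lies in \<open>S\<close>. Perturbing the sequence
  along \<open>h\<close> and passing to the limit shows that the first variation in direction
  \<open>h\<close> vanishes.\<close>

lemma orthogonal_projection:
  assumes sub: "S \<subseteq> H" and zero: "(\<lambda>x. 0) \<in> S"
    and lin: "\<And>f g c. \<lbrakk>f \<in> S; g \<in> S\<rbrakk> \<Longrightarrow> (\<lambda>x. f x + c * g x) \<in> S"
    and closed: "\<And>F f. \<lbrakk>\<And>n. F n \<in> S; f \<in> H;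
        (\<lambda>n. native_norm ip (\<lambda>x. F n x - f x)) \<longlonglongrightarrow> 0\<rbrakk> \<Longrightarrow> f \<in> S"
    and f: "f \<in> H"
  shows "\<exists>g\<in>S. \<forall>h\<in>S. ip (\<lambda>x. f x - g x) h = 0"
proof -
  define q where "q g = ip (\<lambda>x. f x - g x) (\<lambda>x. f x - g x)" for g
  define d where "d = (INF g\<in>S. q g)"
  have SH: "g \<in> H" if "g \<in> S" for g
    using sub that by blast
  have bdd: "bdd_below (q ` S)"
    by (rule bdd_belowI2[where m = 0]) (simp add: q_def ip_nonneg diff_mem f SH)
  have d_le: "d \<le> q g" if "g \<in> S" for g
    unfolding d_def using bdd that by (rule cINF_lower)
  have "\<exists>g\<in>S. q g < d + 1 / Suc n" for n
    using cINF_less_iff[of S q "d + 1 / Suc n"] bdd zero unfolding d_def by fastforce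
  then obtain G where G: "\<And>n. G n \<in> S" and qG: "\<And>n. q (G n) < d + 1 / Suc n"
    by metis
  have mid: "(\<lambda>x. (1/2) * (g x + h x)) \<in> S" if "g \<in> S" "h \<in> S" for g h
    using lin[OF zero lin[OF that, of 1], of "1/2"] by simp
  \<comment> \<open>The midpoint of \<open>G m\<close> and \<open>G n\<close> lies in
    \<open>S\<close>, so its \<open>q\<close> is at least \<open>d\<close>; the term
    \<open>-4 * d\<close> then cancels the two terms \<open>2 * d\<close>, leaving only the
    errors.\<close>
  have close: "ip (\<lambda>x. G m x - G n x) (\<lambda>x. G m x - G n x) \<le> 2 / Suc m + 2 / Suc n" for m n
    using ip_parallelogram[OF SH SH f, OF G G, of m n] d_le[OF mid[OF G G, of m n]]
      qG[of m] qG[of n] by (simp add: q_def)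
  have "\<exists>N. \<forall>m\<ge>N. \<forall>n\<ge>N. native_norm ip (\<lambda>x. G m x - G n x) < e" if "0 < e" for e
  proof -
    obtain N where N: "inverse (real (Suc N)) < e\<^sup>2 / 4"
      using reals_Archimedean[of "e\<^sup>2 / 4"] \<open>0 < e\<close> by auto
    have inv: "1 / real (Suc n) < e\<^sup>2 / 4" if "n \<ge> N" for n
    proof -
      have "1 / real (Suc n) \<le> inverse (real (Suc N))"
        using that by (simp add: field_simps)
      with N show ?thesis by simp
    qed
    have "native_norm ip (\<lambda>x. G m x - G n x) < e" if "m \<ge> N" "n \<ge> N" for m n
    proof -
      have "ip (\<lambda>x. G m x - G n x) (\<lambda>x. G m x - G n x) < e\<^sup>2"
        using close[of m n] inv[OF that(1)] inv[OF that(2)] by simp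
      then show ?thesis
        using \<open>0 < e\<close> real_sqrt_less_mono by (fastforce simp: native_norm_def)
    qed
    then show ?thesis by blast
  qed
  then obtain g where g: "g \<in> H" and lim: "(\<lambda>n. native_norm ip (\<lambda>x. G n x - g x)) \<longlonglongrightarrow> 0"
    using complete[of G] SH[OF G] by blast
  have gS: "g \<in> S"
    using G g lim by (rule closed)
  have "ip (\<lambda>x. f x - g x) h = 0" if h: "h \<in> S" for h
  proof -
    have limG: "(\<lambda>n. ip (\<lambda>x. f x - G n x) h) \<longlonglongrightarrow> ip (\<lambda>x. f x - g x) h"
      using tendsto_diff[OF tendsto_const tendsto_ip_left[OF SH[OF G] g SH[OF h] lim], of "ip f h"]
      by (simp add: ip_diff_left f g SH[OF h] SH[OF G])
    have nonneg: "0 \<le> 2 * c * ip (\<lambda>x. f x - g x) h + c\<^sup>2 * ip h h" for c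
    proof -
      \<comment> \<open>Moving from \<open>G n\<close> within \<open>S\<close> cannot bring
        \<open>q\<close> below \<open>d\<close>, and \<open>q (G n)\<close> exceeds \<open>d\<close>
        by less than \<open>1 / Suc n\<close>.\<close>
      have "0 \<le> 1 / real (Suc n) + 2 * c * ip (\<lambda>x. f x - G n x) h + c\<^sup>2 * ip h h" for n
      proof -
        have "d \<le> q (\<lambda>x. G n x + (-c) * h x)"
          using d_le lin G h by blast
        also have "\<dots> = ip (\<lambda>x. (f x - G n x) + c * h x) (\<lambda>x. (f x - G n x) + c * h x)"
          by (simp add: q_def algebra_simps)
        also have "\<dots> = q (G n) + 2 * c * ip (\<lambda>x. f x - G n x) h + c\<^sup>2 * ip h h"
          using ip_add_scale_self[OF diff_mem[OF f SH[OF G]] SH[OF h]] by (simp add: q_def)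
        finally show ?thesis
          using qG[of n] by simp
      qed
      moreover have "(\<lambda>n. 1 / real (Suc n) + 2 * c * ip (\<lambda>x. f x - G n x) h + c\<^sup>2 * ip h h)
          \<longlonglongrightarrow> 0 + 2 * c * ip (\<lambda>x. f x - g x) h + c\<^sup>2 * ip h h"
        using LIMSEQ_inverse_real_of_nat
        by (intro tendsto_intros limG) (simp add: inverse_eq_divide)
      ultimately show ?thesis
        using LIMSEQ_le_const[of _ "0 + 2 * c * ip (\<lambda>x. f x - g x) h + c\<^sup>2 * ip h h" 0] by simp
    qed
    define a where "a = ip (\<lambda>x. f x - g x) h"
    \<comment> \<open>The extra 1 keeps \<open>t\<close> positive even for \<open>h = 0\<close>, so
      \<open>c = - a / t\<close> can be inserted without a case split. Multiplying the resulting
      inequality by \<open>t^2\<close> clears denominators.\<close>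
    define t where "t = 1 + ip h h"
    have t: "0 < t"
      using ip_nonneg[OF SH[OF h]] by (simp add: t_def)
    have "0 \<le> (- 2 * a\<^sup>2 / t + (a / t)\<^sup>2 * (t - 1)) * t\<^sup>2"
      using nonneg[of "- a / t"] t
      by (intro mult_nonneg_nonneg) (simp_all add: a_def t_def power2_eq_square)
    also have "\<dots> = - a\<^sup>2 * (t + 1)"
      using t by (simp add: field_simps power2_eq_square)
    finally have "a\<^sup>2 * (t + 1) \<le> 0"
      by simp
    then have "a = 0"
      using t by (simp add: mult_le_0_iff)
    then show ?thesis
      by (simp add: a_def)
  qed
  with gS show ?thesis
    by blast
qed

section \<open>Uniqueness of norm minimisers\<close>

lemma norm_minimiser_unique:
  assumes sub: "C \<subseteq> H"
    and mid: "\<And>f g. \<lbrakk>f \<in> C; g \<in> C\<rbrakk> \<Longrightarrow> (\<lambda>x. (1/2) * (f x + g x)) \<in> C"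
    and f: "f \<in> C" "native_norm ip f = (INF h\<in>C. native_norm ip h)"
    and g: "g \<in> C" "native_norm ip g = (INF h\<in>C. native_norm ip h)"
  shows "f = g"
proof -
  let ?m = "\<lambda>x. (1/2) * (f x + g x)"
  have fH: "f \<in> H" and gH: "g \<in> H" and mH: "?m \<in> H"
    using sub f(1) g(1) mid by blast+
  have "bdd_below (native_norm ip ` C)"
    using sub by (intro bdd_belowI2[where m = 0] native_norm_nonneg) blast
  then have "native_norm ip f \<le> native_norm ip ?m"
    unfolding f(2) using mid f(1) g(1) by (intro cINF_lower)
  then have "ip f f \<le> ip ?m ?m"
    by (simp add: native_norm_def)
  moreover have "ip f f = ip g g"
    using f(2) g(2) native_norm_sq[OF fH] native_norm_sq[OF gH] by simp
  \<comment> \<open>The first two terms add up to \<open>4 * ip f f\<close>, which the last one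
    outweighs because the midpoint has norm at least that of \<open>f\<close>.\<close>
  moreover have "ip (\<lambda>x. f x - g x) (\<lambda>x. f x - g x) = 2 * ip f f + 2 * ip g g - 4 * ip ?m ?m"
    using fH gH mH ip_commute[OF fH gH]
    by (simp only: ip_add_left ip_add_right ip_diff_left ip_diff_right ip_scale_left ip_scale_right
      add_mem diff_mem scale_mem) (simp add: algebra_simps)
  ultimately have "\<not> 0 < ip (\<lambda>x. f x - g x) (\<lambda>x. f x - g x)"
    by simp
  then have "(\<lambda>x. f x - g x) = (\<lambda>x. 0)"
    using ip_pos[OF diff_mem[OF fH gH]] by blast
  then show ?thesis
    by (auto simp: fun_eq_iff)
qed

end

section \<open>Kernel sections and isometries of the native space\<close>

context native_space
begin

text \<open>The residual of the projection onto \<open>S\<close> is orthogonal to every kernel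
  section, hence vanishes at every point by reproduction. This acts as an induction principle: a
  linear property closed under norm limits holds on \<open>H\<close> once it holds for the
  sections.\<close>

lemma dense_kernels:
  assumes sub: "S \<subseteq> H" and zero: "(\<lambda>x. 0) \<in> S"
    and lin: "\<And>f g c. \<lbrakk>f \<in> S; g \<in> S\<rbrakk> \<Longrightarrow> (\<lambda>x. f x + c * g x) \<in> S"
    and closed: "\<And>F f. \<lbrakk>\<And>n. F n \<in> S; f \<in> H;
        (\<lambda>n. native_norm ip (\<lambda>x. F n x - f x)) \<longlonglongrightarrow> 0\<rbrakk> \<Longrightarrow> f \<in> S"
    and kernels: "\<And>y. (\<lambda>x. K x y) \<in> S"
  shows "S = H"
proof
  show "H \<subseteq> S"
  proof
    fix f assume f: "f \<in> H"
    have "\<exists>g\<in>S. \<forall>h\<in>S. ip (\<lambda>x. f x - g x) h = 0"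
      by (rule orthogonal_projection[OF sub zero _ _ f]) (fact lin, fact closed)
    then obtain g where g: "g \<in> S" and orth: "\<And>h. h \<in> S \<Longrightarrow> ip (\<lambda>x. f x - g x) h = 0"
      by blast
    have "f y - g y = 0" for y
      using reproducing[OF diff_mem[OF f], of g y] orth[OF kernels] g sub by auto
    then have "f = g"
      by (auto simp: fun_eq_iff)
    with g show "f \<in> S" by simp
  qed
qed (rule sub)

lemma pointwise_limit:
  assumes "\<And>n. F n \<in> H" "f \<in> H" "(\<lambda>n. native_norm ip (\<lambda>x. F n x - f x)) \<longlonglongrightarrow> 0"
  shows "(\<lambda>n. F n x) \<longlonglongrightarrow> f x"
  using tendsto_ip_left[OF assms(1,2) kernel_mem assms(3)] by (simp add: reproducing assms(1,2))

text \<open>By surjectivity every section is centred at some \<open>T z\<close>, and composing it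
  with \<open>T\<close> gives the section at \<open>z\<close>. So the claim holds for sections by
  reproduction, and density extends it to \<open>H\<close>.\<close>

lemma composition_isometry:
  fixes T :: "'a \<Rightarrow> 'a"
  assumes surj: "surj T" and inv: "\<And>x y. K (T x) (T y) = K x y" and f: "f \<in> H"
  shows "(\<lambda>x. f (T x)) \<in> H" and "native_norm ip (\<lambda>x. f (T x)) = native_norm ip f"
proof -
  text \<open>The isometry property is required against all \<open>h\<close> rather than for the norm alone, so that
    \<open>S\<close> is visibly a linear subspace.\<close>
  define S where "S = {g \<in> H. (\<lambda>x. g (T x)) \<in> H \<and>
    (\<forall>h\<in>H. (\<lambda>x. h (T x)) \<in> H \<longrightarrow> ip (\<lambda>x. g (T x)) (\<lambda>x. h (T x)) = ip g h)}"
  have lin: "(\<lambda>x. g x + c * k x) \<in> S" if "g \<in> S" "k \<in> S" for g k c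
    using that add_mem scale_mem by (simp add: S_def ip_add_left ip_scale_left)
  \<comment> \<open>Take \<open>h = g\<close> in the definition of \<open>S\<close>.\<close>
  have norm_S: "native_norm ip (\<lambda>x. g (T x)) = native_norm ip g" if "g \<in> S" for g
    using that by (simp add: S_def native_norm_def)
  have "S = H"
  proof (rule dense_kernels)
    show "S \<subseteq> H"
      by (auto simp: S_def)
    show "(\<lambda>x. 0) \<in> S"
      by (simp add: S_def zero_mem ip_zero_left)
    show "(\<lambda>x. g x + c * k x) \<in> S" if "g \<in> S" "k \<in> S" for g k c
      using that by (rule lin)
    show "(\<lambda>x. K x y) \<in> S" for y
    proof -
      obtain z where z: "y = T z"
        using surj by (rule surjE)
      have eq: "(\<lambda>x. K (T x) y) = (\<lambda>x. K x z)"
        by (simp add: z inv)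
      \<comment> \<open>Both sides reproduce the value \<open>h (T z)\<close>.\<close>
      have "ip (\<lambda>x. K x z) (\<lambda>x. h (T x)) = ip (\<lambda>x. K x y) h"
        if "h \<in> H" "(\<lambda>x. h (T x)) \<in> H" for h
        by (simp add: ip_commute[OF kernel_mem] reproducing that z)
      then show ?thesis
        by (simp add: S_def eq kernel_mem)
    qed
    show "g \<in> S" if G: "\<And>n. G n \<in> S" and g: "g \<in> H"
      and lim: "(\<lambda>n. native_norm ip (\<lambda>x. G n x - g x)) \<longlonglongrightarrow> 0" for G g
    proof -
      have GH: "G n \<in> H" and GT: "(\<lambda>x. G n (T x)) \<in> H" for n
        using G[of n] by (auto simp: S_def)
      \<comment> \<open>Differences of members of \<open>S\<close> lie in \<open>S\<close>, where
        composition preserves the norm; so the composed sequence is Cauchy and has a limit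
        \<open>k\<close> in \<open>H\<close>.\<close>
      have "native_norm ip (\<lambda>x. G m (T x) - G n (T x)) = native_norm ip (\<lambda>x. G m x - G n x)" for m n
      proof -
        have "(\<lambda>x. G m x - G n x) \<in> S"
          using lin[OF G G, of m "-1" n] by simp
        then show ?thesis
          by (rule norm_S)
      qed
      then have "\<exists>N. \<forall>m\<ge>N. \<forall>n\<ge>N. native_norm ip (\<lambda>x. G m (T x) - G n (T x)) < e" if "0 < e" for e
        using convergent_imp_cauchy[OF GH g lim that] by simp
      then obtain k where k: "k \<in> H"
        and klim: "(\<lambda>n. native_norm ip (\<lambda>x. G n (T x) - k x)) \<longlonglongrightarrow> 0"
        using complete[of "\<lambda>n x. G n (T x)"] GT by blast
      \<comment> \<open>Norm limits are pointwise limits, which identifies the abstract limit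
        \<open>k\<close>.\<close>
      have "k x = g (T x)" for x
        using pointwise_limit[OF GT k klim] pointwise_limit[OF GH g lim] by (rule LIMSEQ_unique)
      then have k_eq: "k = (\<lambda>x. g (T x))"
        by blast
      have "ip (\<lambda>x. g (T x)) (\<lambda>x. h (T x)) = ip g h"
        if h: "h \<in> H" and hT: "(\<lambda>x. h (T x)) \<in> H" for h
      proof -
        have "(\<lambda>n. ip (G n) h) \<longlonglongrightarrow> ip k (\<lambda>x. h (T x))"
          using tendsto_ip_left[OF GT k hT klim] G h hT by (simp add: S_def)
        then show ?thesis
          unfolding k_eq using tendsto_ip_left[OF GH g h lim] by (rule LIMSEQ_unique)
      qed
      then show ?thesis
        using g k by (simp add: S_def k_eq)
    qed
  qed
  with f have "f \<in> S" by simp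
  then show "(\<lambda>x. f (T x)) \<in> H" "native_norm ip (\<lambda>x. f (T x)) = native_norm ip f"
    using norm_S by (auto simp: S_def)
qed

end

section \<open>Radiality of the minimal bump function\<close>

theorem corollary2:
  fixes K :: "real ^ 'd \<Rightarrow> real ^ 'd \<Rightarrow> real"
    and H :: "(real ^ 'd \<Rightarrow> real) set"
    and ip :: "(real ^ 'd \<Rightarrow> real) \<Rightarrow> (real ^ 'd \<Rightarrow> real) \<Rightarrow> real"
    and \<phi> :: "real \<Rightarrow> real"
    and r :: real
    and b :: "real ^ 'd \<Rightarrow> real"
  assumes "continuous_on UNIV (\<lambda>(x, y). K x y)"
    and "symmetric_kernel K"
    and "positive_definite_kernel K"
    and "translation_invariant_kernel K"
    and "native_space K H ip"
    and "\<And>x y. K x y = \<phi> (norm (x - y))"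
    and "r > 0"
    and "norm_minimal_bump H ip r b"
  shows "radial b"
proof -
  interpret native_space K H ip by fact
  let ?B = "bump_functions H r"
  have b: "b \<in> ?B" "native_norm ip b = (INF c\<in>?B. native_norm ip c)"
    using assms(8) by (auto simp: norm_minimal_bump_def)
  have sub: "?B \<subseteq> H"
    by (auto simp: bump_functions_def)
  have mid: "(\<lambda>x. (1/2) * (f x + g x)) \<in> ?B" if "f \<in> ?B" "g \<in> ?B" for f g
    using that scale_mem[OF add_mem[of f g], of "1/2"] by (simp add: bump_functions_def)
  have "b x = b y" if xy: "norm x = norm y" for x y
  proof -
    obtain T where T: "orthogonal_transformation T" and Txy: "T x = y"
      using orthogonal_transformation_exists[OF xy] by blast
    have "linear T"
      using T by (rule orthogonal_transformation_linear)
    have inv: "K (T u) (T v) = K u v" for u v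
      by (simp add: assms(6) linear_diff[OF \<open>linear T\<close>, symmetric] orthogonal_transformation_norm[OF T])
    have bH: "b \<in> H"
      using b(1) sub by blast
    note iso = composition_isometry[OF orthogonal_transformation_surj[OF T] inv bH]
    have "(\<lambda>x. b (T x)) \<in> ?B"
      using b(1) iso(1)
      by (simp add: bump_functions_def linear_0[OF \<open>linear T\<close>] orthogonal_transformation_norm[OF T])
    then have "b = (\<lambda>x. b (T x))"
      using b iso(2) by (intro norm_minimiser_unique[OF sub mid]) auto
    then show ?thesis
      using Txy by metis
  qed
  \<comment> \<open>The radial profile is \<open>b\<close> at a chosen point of the given norm;
    \<open>x\<close> itself witnesses that such a point exists.\<close>
  then have "b x = b (SOME z. norm z = norm x)" for x
    by (metis (mono_tags, lifting) someI)
  then show ?thesis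
    unfolding radial_def by (intro exI[of _ "\<lambda>t. b (SOME z. norm z = t)"]) blast
qed

end
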